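(* Let $S$ and $\hat S$ be the exact and hybrid data augmentation kernels on $\mathsf X_1$ (defined in the context). Let $\gamma:\mathsf X_2\to[0,1]$ be a measurable function such that $\|Q_{1,z}\|_{\Pi_{1,z}}\le\gamma(z)$ for $M_2$-a.e. $z\in\mathsf X_2$. Let $t$ be a positive integer, and let $\alpha_t\in[0,1]$ be such that $$\int_{\mathsf X_2}\gamma(z)^t\,\Pi_{2,y}(dz)\le\alpha_t$$ for $M_1$-a.e. $y\in\mathsf X_1$. If either (i) $t$ is even, or (ii) $Q_{1,z}$ is positive semi-definite for $M_2$-a.e. $z\in\mathsf X_2$, then, for every $f\in L_0^2(M_1)\setminus\{0\}$, $$0\le\frac{\langle f,\hat Sf\rangle_{M_1}^t}{\|f\|_{M_1}^{2t}}\le\frac{\langle f,Sf\rangle_{M_1}}{\|f\|_{M_1}^2}+\alpha_t.$$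
   Context: $L^2$ conventions. For a probability space $(\mathsf Y,\mathcal F,\omega)$, $L^2(\omega)$ is the real Hilbert space of square-integrable functions (modulo a.e. equality) with inner product $\langle f,g\rangle_\omega=\int fg\,d\omega$ and norm $\|\cdot\|_\omega$; $L_0^2(\omega)=\{f\in L^2(\omega):\int f\,d\omega=0\}$. A Markov transition kernel (Mtk) $K$ on $\mathsf Y$ reversible with respect to $\omega$ acts as a self-adjoint operator on $L_0^2(\omega)$ by $Kf(y)=\int K(y,dy')f(y')$; $\|K\|_\omega\in[0,1]$ is its operator norm on $L_0^2(\omega)$, and $K$ is positive semi-definite if $\langle f,Kf\rangle_\omega\ge0$ for all $f\in L_0^2(\omega)$. Data augmentation setting. $\mathsf X_1,\mathsf X_2$ are Polish spaces with Borel $\sigma$-algebras $\mathcal B_1,\mathcal B_2$, and $\Pi$ is a probability measure on $\mathsf X_1\times\mathsf X_2$. For $(X_1,X_2)\sim\Pi$, $M_1,M_2$ are the marginal distributions of $X_1,X_2$; $\Pi_{2,y}$ is the conditional distribution of $X_2$ given $X_1=y$; $\Pi_{1,z}$ is the conditional distribution of $X_1$ given $X_2=z$. For each $z\in\mathsf X_2$, $Q_{1,z}:\mathsf X_1\times\mathcal B_1\to[0,1]$ is an Mtk reversible with respect to $\Pi_{1,z}$, and $(y,z)\mapsto Q_{1,z}(y,A)$ is measurable for every $A\in\mathcal B_1$. Define $$S(y,dy')=\int_{\mathsf X_2}\Pi_{2,y}(dz)\,\Pi_{1,z}(dy'),\qquad \hat S(y,dy')=\int_{\mathsf X_2}\Pi_{2,y}(dz)\,Q_{1,z}(y,dy').$$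 Both are reversible with respect to $M_1$. *)

theory Defs
  imports "HOL-Probability.Probability"
begin

text \<open>Elements of \<open>L\<^sup>2(\<omega>)\<close> are represented by measurable functions; equality in \<open>L\<^sup>2(\<omega>)\<close> is
  almost-everywhere equality, so a non-zero element is an \<open>f\<close> with \<open>\<not> (AE x in \<omega>. f x = 0)\<close>.\<close>

definition L2 :: "'a measure \<Rightarrow> ('a \<Rightarrow> real) set" where
  "L2 \<omega> = {f \<in> borel_measurable \<omega>. integrable \<omega> (\<lambda>x. (f x)\<^sup>2)}"

definition L20 :: "'a measure \<Rightarrow> ('a \<Rightarrow> real) set" where
  "L20 \<omega> = {f \<in> L2 \<omega>. (\<integral>x. f x \<partial>\<omega>) = 0}"

definition L2_inner :: "'a measure \<Rightarrow> ('a \<Rightarrow> real) \<Rightarrow> ('a \<Rightarrow> real) \<Rightarrow> real" where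
  "L2_inner \<omega> f g = (\<integral>x. f x * g x \<partial>\<omega>)"

definition L2_norm :: "'a measure \<Rightarrow> ('a \<Rightarrow> real) \<Rightarrow> real" where
  "L2_norm \<omega> f = sqrt (L2_inner \<omega> f f)"

definition Mtk :: "'a measure \<Rightarrow> ('a \<Rightarrow> 'a measure) \<Rightarrow> bool" where
  "Mtk N K \<longleftrightarrow> K \<in> N \<rightarrow>\<^sub>M prob_algebra N"

definition reversible :: "'a measure \<Rightarrow> ('a \<Rightarrow> 'a measure) \<Rightarrow> bool" where
  "reversible \<omega> K \<longleftrightarrow> (\<forall>A\<in>sets \<omega>. \<forall>B\<in>sets \<omega>.
     (\<integral>\<^sup>+y\<in>A. emeasure (K y) B \<partial>\<omega>) = (\<integral>\<^sup>+y\<in>B. emeasure (K y) A \<partial>\<omega>))"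

definition kernel_op :: "('a \<Rightarrow> 'a measure) \<Rightarrow> ('a \<Rightarrow> real) \<Rightarrow> 'a \<Rightarrow> real" where
  "kernel_op K f y = (\<integral>y'. f y' \<partial>(K y))"

text \<open>The index set contains \<open>f = 0\<close>, and for \<open>K\<close> a kernel reversible with respect to a probability
  measure \<open>\<omega>\<close> the set of values is bounded by 1, so the real supremum is the true operator norm,
  also in the degenerate case where \<open>L20 \<omega>\<close> has only null elements.\<close>

definition kernel_norm :: "'a measure \<Rightarrow> ('a \<Rightarrow> 'a measure) \<Rightarrow> real" where
  "kernel_norm \<omega> K = (SUP f\<in>{f \<in> L20 \<omega>. L2_norm \<omega> f \<le> 1}. L2_norm \<omega> (kernel_op K f))"

definition pos_semidef :: "'a measure \<Rightarrow> ('a \<Rightarrow> 'a measure) \<Rightarrow> bool" where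
  "pos_semidef \<omega> K \<longleftrightarrow> (\<forall>f\<in>L20 \<omega>. 0 \<le> L2_inner \<omega> f (kernel_op K f))"

definition marginal1 :: "('a::topological_space \<times> 'b::topological_space) measure \<Rightarrow> 'a measure" where
  "marginal1 P = distr P borel fst"

definition marginal2 :: "('a::topological_space \<times> 'b::topological_space) measure \<Rightarrow> 'b measure" where
  "marginal2 P = distr P borel snd"

text \<open>Regular conditional distributions: the predicates below say that a kernel is a version of the
  conditional distribution of one coordinate given the other. Versions are unique only up to a
  null set of the conditioning variable.\<close>

definition cond_dist2 ::
  "('a::topological_space \<times> 'b::topological_space) measure \<Rightarrow> ('a \<Rightarrow> 'b measure) \<Rightarrow> bool" where
  "cond_dist2 P \<kappa> \<longleftrightarrow> \<kappa> \<in> borel \<rightarrow>\<^sub>M prob_algebra borel \<and>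
     (\<forall>A\<in>sets borel. \<forall>B\<in>sets borel.
        emeasure P (A \<times> B) = (\<integral>\<^sup>+y\<in>A. emeasure (\<kappa> y) B \<partial>marginal1 P))"

definition cond_dist1 ::
  "('a::topological_space \<times> 'b::topological_space) measure \<Rightarrow> ('b \<Rightarrow> 'a measure) \<Rightarrow> bool" where
  "cond_dist1 P \<kappa> \<longleftrightarrow> \<kappa> \<in> borel \<rightarrow>\<^sub>M prob_algebra borel \<and>
     (\<forall>A\<in>sets borel. \<forall>B\<in>sets borel.
        emeasure P (A \<times> B) = (\<integral>\<^sup>+z\<in>B. emeasure (\<kappa> z) A \<partial>marginal2 P))"

text \<open>The mixtures \<open>\<integral> \<Pi>\<^sub>2\<^sub>,\<^sub>y(dz) \<Pi>\<^sub>1\<^sub>,\<^sub>z(dy')\<close> and \<open>\<integral> \<Pi>\<^sub>2\<^sub>,\<^sub>y(dz) Q\<^sub>1\<^sub>,\<^sub>z(y, dy')\<close>; the argument order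
  is \<open>Q z y\<close>.\<close>

definition DA_exact :: "('a \<Rightarrow> 'b measure) \<Rightarrow> ('b \<Rightarrow> 'a measure) \<Rightarrow> 'a \<Rightarrow> 'a measure" where
  "DA_exact \<Pi>2 \<Pi>1 y = \<Pi>2 y \<bind> \<Pi>1"

definition DA_hybrid :: "('a \<Rightarrow> 'b measure) \<Rightarrow> ('b \<Rightarrow> 'a \<Rightarrow> 'a measure) \<Rightarrow> 'a \<Rightarrow> 'a measure" where
  "DA_hybrid \<Pi>2 Q y = \<Pi>2 y \<bind> (\<lambda>z. Q z y)"

end

theory Submission imports Defs begin

text \<open>Disintegrating \<open>P\<close> in both directions gives, with \<open>S'\<close> the hybrid kernel,
  \<open>\<langle>f, S' f\<rangle> = \<integral> \<langle>f, Q\<^sub>1\<^sub>,\<^sub>z f\<rangle> M\<^sub>2(dz)\<close>, and \<open>\<langle>f, S f\<rangle> = \<integral> m(z)\<^sup>2 M\<^sub>2(dz)\<close> with \<open>m(z)\<close> the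
  \<open>\<Pi>\<^sub>1\<^sub>,\<^sub>z\<close>-mean of \<open>f\<close>. Writing \<open>v(z)\<close> for the \<open>\<Pi>\<^sub>1\<^sub>,\<^sub>z\<close>-variance of \<open>f\<close>, centering \<open>f\<close> in each fiber yields
  \<open>\<bar>\<langle>f, Q\<^sub>1\<^sub>,\<^sub>z f\<rangle>\<bar> \<le> m(z)\<^sup>2 + \<gamma>(z) v(z)\<close>, while \<open>m\<^sup>2 + v\<close> integrates to \<open>\<parallel>f\<parallel>\<^sup>2\<close>. Jensen's inequality
  for \<open>x\<^sup>t\<close>, with weights \<open>m\<^sup>2\<close> on the value 1 and \<open>v\<close> on the value \<open>\<gamma>\<close>, bounds the normalized \<open>t\<close>-th power by
  \<open>\<integral> (m\<^sup>2 + \<gamma>\<^sup>t v) dM\<^sub>2 / \<parallel>f\<parallel>\<^sup>2\<close>; finally \<open>v(z)\<close> is at most the \<open>\<Pi>\<^sub>1\<^sub>,\<^sub>z\<close>-mean of \<open>f\<^sup>2\<close>, and disintegrating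
  the other way turns the second term into \<open>\<integral> f(y)\<^sup>2 (\<integral> \<gamma>\<^sup>t d\<Pi>\<^sub>2\<^sub>,\<^sub>y) M\<^sub>1(dy) \<le> \<alpha>\<^sub>t \<parallel>f\<parallel>\<^sup>2\<close>. Evenness
  of \<open>t\<close> or positivity of \<open>\<langle>f, S' f\<rangle>\<close> gives the lower bound 0.\<close>

section \<open>Bochner integration against a mixture of kernels\<close>

text \<open>The identity for nonnegative functions is applied to the positive and the negative part
  of \<open>f\<close> separately. Both have finite integral under the mixture, hence finite fiber
  integrals for almost every \<open>x\<close>, and can be subtracted.\<close>

lemma
  fixes f :: "'b \<Rightarrow> real"
  assumes K: "K \<in> M \<rightarrow>\<^sub>M subprob_algebra N" and ne: "space M \<noteq> {}"
    and f: "integrable (M \<bind> K) f"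
  shows AE_integrable_bind: "AE x in M. integrable (K x) f"
    and integrable_integral_bind: "integrable M (\<lambda>x. \<integral>y. f y \<partial>K x)"
    and integral_bind_integrable: "(\<integral>y. f y \<partial>(M \<bind> K)) = (\<integral>x. \<integral>y. f y \<partial>K x \<partial>M)"
proof -
  have sb: "sets (M \<bind> K) = sets N"
    using K ne by (rule sets_bind_measurable)
  have fN[measurable]: "f \<in> borel_measurable N"
    using borel_measurable_integrable[OF f] measurable_cong_sets[OF sb refl] by blast
  note [measurable] = K
  have fK: "f \<in> borel_measurable (K x)" if "x \<in> space M" for x
    using fN subprob_measurableD(3)[OF K that] by blast
  have nn: "(\<integral>\<^sup>+y. g y \<partial>(M \<bind> K)) = (\<integral>\<^sup>+x. \<integral>\<^sup>+y. g y \<partial>K x \<partial>M)"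
    if "g \<in> borel_measurable N" for g
    by (rule nn_integral_bind[OF that K])
  have fin: "(\<integral>\<^sup>+x. \<integral>\<^sup>+y. ennreal \<bar>f y\<bar> \<partial>K x \<partial>M) < \<infinity>"
    using f by (simp add: integrable_iff_bounded nn[symmetric])
  have "AE x in M. (\<integral>\<^sup>+y. ennreal \<bar>f y\<bar> \<partial>K x) \<noteq> \<infinity>"
    using fin by (intro nn_integral_PInf_AE) auto
  then show ae: "AE x in M. integrable (K x) f"
    using AE_space by eventually_elim (auto simp: integrable_iff_bounded fK less_top)
  \<comment> \<open>Since \<open>ennreal\<close> sends negative numbers to 0, only the positive part
    of \<open>g\<close> enters; \<open>g = f\<close> and \<open>g = - f\<close> supply the two parts
    of \<open>f\<close>. An infinite fiber integral is sent to 0 by \<open>enn2real\<close>, but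
    this happens only on a null set.\<close>
  have half: "integrable M (\<lambda>x. enn2real (\<integral>\<^sup>+y. ennreal (g y) \<partial>K x)) \<and>
      (\<integral>x. enn2real (\<integral>\<^sup>+y. ennreal (g y) \<partial>K x) \<partial>M) = enn2real (\<integral>\<^sup>+y. ennreal (g y) \<partial>(M \<bind> K))"
    if g: "integrable (M \<bind> K) g" and [measurable]: "g \<in> borel_measurable N" for g :: "'b \<Rightarrow> real"
  proof -
    have lt: "(\<integral>\<^sup>+x. \<integral>\<^sup>+y. ennreal (g y) \<partial>K x \<partial>M) < \<infinity>"
      using integrableD(2)[OF g] by (simp add: nn[symmetric] less_top)
    then have "AE x in M. (\<integral>\<^sup>+y. ennreal (g y) \<partial>K x) \<noteq> \<infinity>"
      by (intro nn_integral_PInf_AE) auto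
    then have ae: "AE x in M. ennreal (enn2real (\<integral>\<^sup>+y. ennreal (g y) \<partial>K x)) = (\<integral>\<^sup>+y. ennreal (g y) \<partial>K x)"
      by eventually_elim (auto simp: less_top)
    have eq: "(\<integral>\<^sup>+x. ennreal (enn2real (\<integral>\<^sup>+y. ennreal (g y) \<partial>K x)) \<partial>M)
        = (\<integral>\<^sup>+y. ennreal (g y) \<partial>(M \<bind> K))"
      by (subst nn_integral_cong_AE[OF ae]) (simp add: nn)
    show ?thesis
      using lt eq by (auto intro!: integrableI_nonneg simp: integral_eq_nn_integral nn)
  qed
  have h1: "integrable (M \<bind> K) f" and h2: "integrable (M \<bind> K) (\<lambda>x. - f x)"
    using f by auto
  note p = half[OF h1 fN]
  note n = half[OF h2]
  let ?d = "\<lambda>x. enn2real (\<integral>\<^sup>+y. ennreal (f y) \<partial>K x) - enn2real (\<integral>\<^sup>+y. ennreal (- f y) \<partial>K x)"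
  have m[measurable]: "(\<lambda>x. \<integral>y. f y \<partial>K x) \<in> borel_measurable M"
    by measurable
  have d: "AE x in M. (\<integral>y. f y \<partial>K x) = ?d x"
    using ae by eventually_elim (rule real_lebesgue_integral_def)
  have "integrable M ?d"
    using p n by auto
  then show "integrable M (\<lambda>x. \<integral>y. f y \<partial>K x)"
    using integrable_cong_AE[OF m _ d] by simp
  have "(\<integral>x. \<integral>y. f y \<partial>K x \<partial>M) = integral\<^sup>L M ?d"
    by (intro integral_cong_AE d) auto
  also have "\<dots> = (\<integral>y. f y \<partial>(M \<bind> K))"
    using p n by (simp add: real_lebesgue_integral_def[OF f])
  finally show "(\<integral>y. f y \<partial>(M \<bind> K)) = (\<integral>x. \<integral>y. f y \<partial>K x \<partial>M)" ..
qed

section \<open>Square-integrable functions\<close>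

lemma L2_mult_integrable:
  assumes "f \<in> L2 \<omega>" "g \<in> L2 \<omega>"
  shows "integrable \<omega> (\<lambda>x. f x * g x)"
proof -
  have [measurable]: "f \<in> borel_measurable \<omega>" "g \<in> borel_measurable \<omega>"
    and i: "integrable \<omega> (\<lambda>x. (f x)\<^sup>2 + (g x)\<^sup>2)"
    using assms by (auto simp: L2_def)
  show ?thesis
  proof (rule Bochner_Integration.integrable_bound[OF i])
    have "\<bar>a * b\<bar> \<le> a\<^sup>2 + b\<^sup>2" for a b :: real
      using sum_squares_bound[of "\<bar>a\<bar>" "\<bar>b\<bar>"] mult_nonneg_nonneg[of "\<bar>a\<bar>" "\<bar>b\<bar>"]
      unfolding abs_mult power2_abs by linarith
    then show "AE x in \<omega>. norm (f x * g x) \<le> norm ((f x)\<^sup>2 + (g x)\<^sup>2)"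
      by auto
  qed measurable
qed

lemma L2_norm_power2: "(L2_norm \<omega> f)\<^sup>2 = (\<integral>x. (f x)\<^sup>2 \<partial>\<omega>)"
  by (simp add: L2_norm_def L2_inner_def power2_eq_square[symmetric])

lemma L2_norm_nonneg: "0 \<le> L2_norm \<omega> f"
  by (simp add: L2_norm_def L2_inner_def)

lemma L2_norm_pos:
  assumes "f \<in> L2 \<omega>" and "\<not> (AE x in \<omega>. f x = 0)"
  shows "0 < L2_norm \<omega> f"
proof -
  have "(\<integral>x. (f x)\<^sup>2 \<partial>\<omega>) \<noteq> 0"
    using assms by (subst integral_nonneg_eq_0_iff_AE) (auto simp: L2_def)
  then show ?thesis
    using L2_norm_power2[of \<omega> f] L2_norm_nonneg[of \<omega> f] by (auto simp: less_le)
qed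

text \<open>The squared norm of \<open>f - s * g\<close> is a polynomial in \<open>s\<close> of
  degree at most two without negative values; a good choice of \<open>s\<close> gives the
  inequality.\<close>

lemma L2_Cauchy_Schwarz:
  assumes f: "f \<in> L2 \<omega>" and g: "g \<in> L2 \<omega>"
  shows "\<bar>L2_inner \<omega> f g\<bar> \<le> L2_norm \<omega> f * L2_norm \<omega> g"
proof -
  define A where "A = (L2_norm \<omega> f)\<^sup>2"
  define B where "B = L2_inner \<omega> f g"
  define C where "C = (L2_norm \<omega> g)\<^sup>2"
  have quad: "0 \<le> A - 2 * s * B + s\<^sup>2 * C" for s
  proof -
    have "0 \<le> (\<integral>x. (f x - s * g x)\<^sup>2 \<partial>\<omega>)"
      by simp
    also have "\<dots> = (\<integral>x. (f x)\<^sup>2 - 2 * s * (f x * g x) + s\<^sup>2 * (g x)\<^sup>2 \<partial>\<omega>)"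
      by (intro Bochner_Integration.integral_cong) (auto simp: power2_eq_square algebra_simps)
    also have "\<dots> = A - 2 * s * B + s\<^sup>2 * C"
      using f g L2_mult_integrable[OF f g]
      by (simp add: L2_def A_def B_def C_def L2_norm_power2 L2_inner_def)
    finally show ?thesis .
  qed
  have "B\<^sup>2 \<le> A * C"
  proof (cases "C = 0")
    case True
    have "B = 0"
    proof (rule ccontr)
      assume "B \<noteq> 0"
      \<comment> \<open>Here the polynomial is affine in \<open>s\<close>, and this choice of
        \<open>s\<close> gives it the value -1.\<close>
      then show False using quad[of "(A + 1) / (2 * B)"] True by simp
    qed
    then show ?thesis using True by simp
  next
    case False
    then have "0 < C" by (simp add: C_def)
    \<comment> \<open>The point \<open>B / C\<close> minimizes the quadratic, and the minimum is
      \<open>A - B\<^sup>2 / C\<close>.\<close>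
    then show ?thesis
      using quad[of "B / C"] by (simp add: field_simps power2_eq_square)
  qed
  then have "\<bar>B\<bar>\<^sup>2 \<le> (L2_norm \<omega> f * L2_norm \<omega> g)\<^sup>2"
    by (simp add: A_def C_def power_mult_distrib)
  then show ?thesis
    unfolding B_def by (rule power2_le_imp_le) (simp add: L2_norm_nonneg)
qed

lemma (in prob_space) L2_integrable: "f \<in> L2 M \<Longrightarrow> integrable M f"
  by (auto simp: L2_def intro: square_integrable_imp_integrable)

lemma (in prob_space) power2_expectation_le:
  fixes X :: "'a \<Rightarrow> real"
  assumes "X \<in> L2 M"
  shows "(expectation X)\<^sup>2 \<le> (\<integral>x. (X x)\<^sup>2 \<partial>M)"
proof -
  have "variance X = (\<integral>x. (X x)\<^sup>2 \<partial>M) - (expectation X)\<^sup>2"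
    using assms by (intro variance_eq L2_integrable[OF assms]) (simp add: L2_def)
  then show ?thesis
    using variance_positive[of X] by linarith
qed

text \<open>In almost every fiber the squared mean is at most the mean of the square; integrating
  over \<open>M\<close> gives the bound. Source and target may differ: besides invariant kernels,
  this is applied to \<open>P\<close> and the kernel sending \<open>(y, z)\<close> to
  \<open>Q z y\<close>.\<close>

lemma
  assumes M: "prob_space M" and K: "K \<in> M \<rightarrow>\<^sub>M prob_algebra N" and f: "f \<in> L2 (M \<bind> K)"
  shows L2_kernel_op: "(\<lambda>x. \<integral>y. f y \<partial>K x) \<in> L2 M"
    and L2_kernel_op_contract: "(\<integral>x. (\<integral>y. f y \<partial>K x)\<^sup>2 \<partial>M) \<le> (\<integral>y. (f y)\<^sup>2 \<partial>(M \<bind> K))"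
proof -
  interpret prob_space M by fact
  note Ks = measurable_prob_algebraD[OF K]
  have i2: "integrable (M \<bind> K) (\<lambda>y. (f y)\<^sup>2)" and "f \<in> borel_measurable (M \<bind> K)"
    using f by (auto simp: L2_def)
  then have f_meas: "f \<in> borel_measurable N"
    using measurable_cong_sets[OF sets_bind_measurable[OF Ks not_empty] refl] by blast
  note [measurable] = Ks f_meas
  note b = AE_integrable_bind[OF Ks not_empty i2] integrable_integral_bind[OF Ks not_empty i2]
    integral_bind_integrable[OF Ks not_empty i2]
  have ae: "AE x in M. (\<integral>y. f y \<partial>K x)\<^sup>2 \<le> (\<integral>y. (f y)\<^sup>2 \<partial>K x)"
    using b(1) AE_space
  proof eventually_elim
    case (elim x)
    interpret k: prob_space "K x"
      using measurable_space[OF K elim(2)] by (simp add: space_prob_algebra)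
    have "f \<in> borel_measurable (K x)"
      using f_meas subprob_measurableD(3)[OF Ks elim(2)] by blast
    then show ?case
      using elim(1) by (intro k.power2_expectation_le) (simp add: L2_def)
  qed
  have int: "integrable M (\<lambda>x. (\<integral>y. f y \<partial>K x)\<^sup>2)"
    using ae by (intro Bochner_Integration.integrable_bound[OF b(2)]) auto
  then show "(\<lambda>x. \<integral>y. f y \<partial>K x) \<in> L2 M"
    by (simp add: L2_def)
  show "(\<integral>x. (\<integral>y. f y \<partial>K x)\<^sup>2 \<partial>M) \<le> (\<integral>y. (f y)\<^sup>2 \<partial>(M \<bind> K))"
    unfolding b(3) by (intro integral_mono_AE int b(2) ae)
qed

section \<open>Kernels with an invariant law as operators on L2\<close>

lemma Mtk_cong: "sets \<omega> = sets N \<Longrightarrow> Mtk \<omega> K \<longleftrightarrow> Mtk N K"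
  unfolding Mtk_def prob_algebra_def
  by (simp add: measurable_cong_sets[of \<omega> N, OF _ refl] subprob_algebra_cong[of \<omega> N])

text \<open>Take one of the two sets in the reversibility identity to be the whole space, where
  every \<open>K y\<close> has mass 1.\<close>

lemma reversible_bind:
  assumes \<omega>: "prob_space \<omega>" and K: "Mtk \<omega> K" and rev: "reversible \<omega> K"
  shows "\<omega> \<bind> K = \<omega>"
proof (rule measure_eqI)
  interpret prob_space \<omega> by fact
  note Ks = measurable_prob_algebraD[OF K[unfolded Mtk_def]]
  show s: "sets (\<omega> \<bind> K) = sets \<omega>"
    by (rule sets_bind_measurable[OF Ks not_empty])
  fix A assume "A \<in> sets (\<omega> \<bind> K)"
  then have A: "A \<in> sets \<omega>" using s by simp
  have one: "emeasure (K y) (space \<omega>) = 1" if "y \<in> space \<omega>" for y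
    using measurable_space[OF K[unfolded Mtk_def] that] by (rule in_space_prob_algebra)
  have "emeasure (\<omega> \<bind> K) A = (\<integral>\<^sup>+y\<in>space \<omega>. emeasure (K y) A \<partial>\<omega>)"
    unfolding emeasure_bind[OF not_empty Ks A] by (intro nn_integral_cong) simp
  also have "\<dots> = (\<integral>\<^sup>+y\<in>A. emeasure (K y) (space \<omega>) \<partial>\<omega>)"
    using rev A unfolding reversible_def by blast
  also have "\<dots> = (\<integral>\<^sup>+y. indicator A y \<partial>\<omega>)"
    by (intro nn_integral_cong) (simp add: one)
  finally show "emeasure (\<omega> \<bind> K) A = emeasure \<omega> A"
    using A by simp
qed

text \<open>Invariance, which reversibility implies, makes the kernel a contraction that preserves
  means. The locale covers the fiber kernels \<open>Q z\<close>, the constant kernel with value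
  \<open>\<Pi>1 z\<close>, and the hybrid kernel alike.\<close>

locale stationary_kernel = prob_space \<omega> for \<omega> :: "'a measure" +
  fixes K :: "'a \<Rightarrow> 'a measure"
  assumes Mtk: "Mtk \<omega> K" and stationary: "\<omega> \<bind> K = \<omega>"
begin

lemma kernel_subprob: "K \<in> \<omega> \<rightarrow>\<^sub>M subprob_algebra \<omega>"
  using Mtk unfolding Mtk_def by (rule measurable_prob_algebraD)

lemma
  assumes "f \<in> L2 \<omega>"
  shows AE_kernel_integrable: "AE y in \<omega>. integrable (K y) f"
    and integral_kernel_op: "(\<integral>y. kernel_op K f y \<partial>\<omega>) = (\<integral>y. f y \<partial>\<omega>)"
  using AE_integrable_bind[OF kernel_subprob not_empty, of f]
    integral_bind_integrable[OF kernel_subprob not_empty, of f] L2_integrable[OF assms]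
  by (simp_all add: stationary kernel_op_def)

lemma kernel_op_L2:
  assumes "f \<in> L2 \<omega>"
  shows "kernel_op K f \<in> L2 \<omega>" and "L2_norm \<omega> (kernel_op K f) \<le> L2_norm \<omega> f"
proof -
  note L2_kernel_op[OF prob_space_axioms Mtk[unfolded Mtk_def], of f]
    L2_kernel_op_contract[OF prob_space_axioms Mtk[unfolded Mtk_def], of f]
  note * = this[unfolded stationary, OF assms, folded kernel_op_def]
  show "kernel_op K f \<in> L2 \<omega>" using *(1) by (simp add: kernel_op_def[abs_def])
  show "L2_norm \<omega> (kernel_op K f) \<le> L2_norm \<omega> f"
    by (rule power2_le_imp_le) (use *(2) in \<open>simp_all add: L2_norm_power2 L2_norm_nonneg\<close>)
qed

text \<open>By homogeneity \<open>g\<close> may be scaled to norm 1. If \<open>g\<close> has norm 0,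
  no scaling is possible, and the contraction property shows that its image also has norm 0.\<close>

lemma kernel_norm_bound:
  assumes g: "g \<in> L20 \<omega>"
  shows "L2_norm \<omega> (kernel_op K g) \<le> kernel_norm \<omega> K * L2_norm \<omega> g"
proof (cases "L2_norm \<omega> g = 0")
  case True
  then show ?thesis
    using kernel_op_L2(2)[of g] g by (simp add: L20_def)
next
  case False
  define n where "n = L2_norm \<omega> g"
  have n: "0 < n" using False L2_norm_nonneg[of \<omega> g] by (simp add: n_def)
  have scale: "L2_norm \<omega> (\<lambda>x. h x / n) = L2_norm \<omega> h / n" for h :: "'a \<Rightarrow> real"
    using n by (simp add: L2_norm_def L2_inner_def real_sqrt_divide)
  let ?S = "{f \<in> L20 \<omega>. L2_norm \<omega> f \<le> 1}"
  have "(\<lambda>x. g x / n) \<in> ?S"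
    using g n scale[of g] by (auto simp: L20_def L2_def power_divide n_def)
  \<comment> \<open>The supremum of a set of reals is an upper bound only if the set is bounded
    above; the contraction property supplies the bound 1.\<close>
  moreover have "bdd_above ((\<lambda>f. L2_norm \<omega> (kernel_op K f)) ` ?S)"
  proof (rule bdd_aboveI2)
    fix f assume "f \<in> ?S"
    then show "L2_norm \<omega> (kernel_op K f) \<le> 1"
      using kernel_op_L2(2)[of f] by (simp add: L20_def)
  qed
  ultimately have "L2_norm \<omega> (kernel_op K (\<lambda>x. g x / n)) \<le> kernel_norm \<omega> K"
    unfolding kernel_norm_def by (rule cSUP_upper)
  moreover have "kernel_op K (\<lambda>x. g x / n) = (\<lambda>x. kernel_op K g x / n)"
    by (simp add: kernel_op_def fun_eq_iff)
  ultimately have "L2_norm \<omega> (kernel_op K g) / n \<le> kernel_norm \<omega> K"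
    by (simp add: scale)
  then show ?thesis
    using n by (simp add: divide_le_eq n_def)
qed

lemma centered_L20:
  assumes "f \<in> L2 \<omega>"
  shows "(\<lambda>x. f x - expectation f) \<in> L20 \<omega>"
  using assms L2_integrable[OF assms]
  by (auto simp: L20_def L2_def power2_diff prob_space)

lemma L2_norm_centered:
  assumes "f \<in> L2 \<omega>"
  shows "(L2_norm \<omega> (\<lambda>x. f x - expectation f))\<^sup>2 = (L2_norm \<omega> f)\<^sup>2 - (expectation f)\<^sup>2"
  unfolding L2_norm_power2
  using assms by (intro variance_eq L2_integrable[OF assms]) (simp add: L2_def)

text \<open>The operator fixes constants and preserves the mean \<open>a\<close> of
  \<open>f\<close>. Expanding the product therefore leaves
  \<open>- a\<^sup>2 - a\<^sup>2 + a\<^sup>2\<close> besides the inner product for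
  \<open>f\<close>.\<close>

lemma L2_inner_centered:
  assumes f: "f \<in> L2 \<omega>"
  defines "g \<equiv> \<lambda>x. f x - expectation f"
  shows "L2_inner \<omega> g (kernel_op K g) = L2_inner \<omega> f (kernel_op K f) - (expectation f)\<^sup>2"
proof -
  let ?a = "expectation f"
  have g: "g \<in> L2 \<omega>"
    using centered_L20[OF f] by (simp add: g_def L20_def)
  note Kf = kernel_op_L2(1)[OF f] and Kg = kernel_op_L2(1)[OF g]
  \<comment> \<open>This can fail where \<open>f\<close> is not integrable under \<open>K y\<close>:
    both integrals then take the default value 0. Such points form a null set.\<close>
  have "AE y in \<omega>. kernel_op K g y = kernel_op K f y - ?a"
    using AE_kernel_integrable[OF f] AE_space
  proof eventually_elim
    case (elim y)
    interpret k: prob_space "K y"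
      using measurable_space[OF Mtk[unfolded Mtk_def] elim(2)] by (simp add: space_prob_algebra)
    show ?case
      using elim(1) by (simp add: kernel_op_def g_def k.prob_space)
  qed
  then have "L2_inner \<omega> g (kernel_op K g) = (\<integral>y. g y * (kernel_op K f y - ?a) \<partial>\<omega>)"
    unfolding L2_inner_def using g Kf Kg
    by (intro integral_cong_AE) (auto simp: L2_def)
  also have "\<dots> = (\<integral>y. f y * kernel_op K f y - ?a * kernel_op K f y - ?a * f y + ?a\<^sup>2 \<partial>\<omega>)"
    by (intro Bochner_Integration.integral_cong) (auto simp: g_def power2_eq_square algebra_simps)
  also have "\<dots> = L2_inner \<omega> f (kernel_op K f) - ?a\<^sup>2"
    using L2_mult_integrable[OF f Kf] L2_integrable[OF f] L2_integrable[OF Kf]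
    by (simp add: L2_inner_def prob_space integral_kernel_op[OF f] power2_eq_square)
  finally show ?thesis .
qed

text \<open>On the constant part of \<open>f\<close> the operator is the identity, which contributes
  the squared mean. On the centered part Cauchy-Schwarz and the operator norm give
  \<open>\<gamma>\<close> times the variance.\<close>

lemma abs_L2_inner_kernel_le:
  assumes f: "f \<in> L2 \<omega>" and \<gamma>: "kernel_norm \<omega> K \<le> \<gamma>"
  shows "\<bar>L2_inner \<omega> f (kernel_op K f)\<bar>
    \<le> (expectation f)\<^sup>2 + \<gamma> * ((\<integral>x. (f x)\<^sup>2 \<partial>\<omega>) - (expectation f)\<^sup>2)"
proof -
  define g where "g = (\<lambda>x. f x - expectation f)"
  have g: "g \<in> L20 \<omega>" "g \<in> L2 \<omega>"
    using centered_L20[OF f] by (auto simp: g_def L20_def)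
  have "\<bar>L2_inner \<omega> g (kernel_op K g)\<bar> \<le> L2_norm \<omega> g * L2_norm \<omega> (kernel_op K g)"
    by (intro L2_Cauchy_Schwarz g kernel_op_L2)
  also have "\<dots> \<le> L2_norm \<omega> g * (kernel_norm \<omega> K * L2_norm \<omega> g)"
    by (intro mult_left_mono kernel_norm_bound g L2_norm_nonneg)
  also have "\<dots> \<le> \<gamma> * (L2_norm \<omega> g)\<^sup>2"
    using mult_right_mono[OF \<gamma>, of "(L2_norm \<omega> g)\<^sup>2"] by (simp add: power2_eq_square mult_ac)
  finally have "\<bar>L2_inner \<omega> f (kernel_op K f) - (expectation f)\<^sup>2\<bar>
      \<le> \<gamma> * ((L2_norm \<omega> f)\<^sup>2 - (expectation f)\<^sup>2)"
    unfolding L2_norm_centered[OF f, folded g_def] L2_inner_centered[OF f, folded g_def] .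
  then show ?thesis
    unfolding L2_norm_power2 using zero_le_power2[of "expectation f"] by linarith
qed

text \<open>Positivity is assumed on mean-zero functions only; the constant part adds the squared
  mean.\<close>

lemma pos_semidef_L2_inner_nonneg:
  assumes f: "f \<in> L2 \<omega>" and "pos_semidef \<omega> K"
  shows "0 \<le> L2_inner \<omega> f (kernel_op K f)"
proof -
  let ?g = "\<lambda>x. f x - expectation f"
  have "0 \<le> L2_inner \<omega> ?g (kernel_op K ?g)"
    using assms centered_L20[OF f] by (simp only: pos_semidef_def)
  then show ?thesis
    using L2_inner_centered[OF f] zero_le_power2[of "expectation f"] by linarith
qed

end

section \<open>Disintegration of the joint law in both directions\<close>

text \<open>Rectangles form an intersection-stable generator of the product sigma-algebra, and
  \<open>P\<close> is finite on the whole space, so agreement on rectangles suffices.\<close>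

lemma measure_eqI_pair:
  assumes P: "prob_space P" and PS: "sets P = sets (M \<Otimes>\<^sub>M N)" and RS: "sets R = sets (M \<Otimes>\<^sub>M N)"
    and eq: "\<And>A B. A \<in> sets M \<Longrightarrow> B \<in> sets N \<Longrightarrow> emeasure P (A \<times> B) = emeasure R (A \<times> B)"
  shows "P = R"
proof (rule measure_eqI_generator_eq[OF Int_stable_pair_measure_generator[of M N] pair_measure_closed])
  interpret prob_space P by fact
  show "range (\<lambda>_::nat. space M \<times> space N) \<subseteq> {a \<times> b |a b. a \<in> sets M \<and> b \<in> sets N}"
    by auto
  show "emeasure P ((\<lambda>_::nat. space M \<times> space N) i) \<noteq> \<infinity>" for i
    by simp
qed (use PS RS eq in \<open>auto simp: sets_pair_measure\<close>)

text \<open>The map \<open>c\<close> pairs the mixing variable with the drawn one. Leaving it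
  abstract lets one lemma serve both orders of the pair, and so both disintegrations.\<close>

lemma
  fixes h :: "'c \<Rightarrow> real"
  assumes K: "K \<in> R \<rightarrow>\<^sub>M subprob_algebra L" and ne: "space R \<noteq> {}"
    and c: "case_prod c \<in> R \<Otimes>\<^sub>M L \<rightarrow>\<^sub>M N"
    and h: "integrable (R \<bind> (\<lambda>x. distr (K x) N (c x))) h"
  shows AE_integrable_bind_distr: "AE x in R. integrable (K x) (\<lambda>y. h (c x y))"
    and integrable_integral_bind_distr: "integrable R (\<lambda>x. \<integral>y. h (c x y) \<partial>K x)"
    and integral_bind_distr: "(\<integral>w. h w \<partial>(R \<bind> (\<lambda>x. distr (K x) N (c x)))) = (\<integral>x. \<integral>y. h (c x y) \<partial>K x \<partial>R)"
proof -
  have D: "(\<lambda>x. distr (K x) N (c x)) \<in> R \<rightarrow>\<^sub>M subprob_algebra N"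
    by (rule measurable_distr2[OF c K])
  have hN: "h \<in> borel_measurable N"
    using borel_measurable_integrable[OF h] measurable_cong_sets[OF sets_bind_measurable[OF D ne] refl]
    by blast
  have cx: "c x \<in> K x \<rightarrow>\<^sub>M N" if "x \<in> space R" for x
  proof -
    have "c x \<in> L \<rightarrow>\<^sub>M N"
      using measurable_compose[OF measurable_Pair1'[OF that] c] by simp
    then show ?thesis
      using subprob_measurableD(3)[OF K that, of N] by simp
  qed
  have int: "integral\<^sup>L (distr (K x) N (c x)) h = (\<integral>y. h (c x y) \<partial>K x)" if "x \<in> space R" for x
    by (rule integral_distr[OF cx[OF that] hN])
  show "AE x in R. integrable (K x) (\<lambda>y. h (c x y))"
    using AE_integrable_bind[OF D ne h] AE_space
    by eventually_elim (simp add: integrable_distr_eq[OF cx hN])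
  show "integrable R (\<lambda>x. \<integral>y. h (c x y) \<partial>K x)"
    using integrable_integral_bind[OF D ne h]
    by (subst Bochner_Integration.integrable_cong[OF refl int[symmetric]])
  show "(\<integral>w. h w \<partial>(R \<bind> (\<lambda>x. distr (K x) N (c x)))) = (\<integral>x. \<integral>y. h (c x y) \<partial>K x \<partial>R)"
    unfolding integral_bind_integrable[OF D ne h]
    by (intro Bochner_Integration.integral_cong refl int)
qed

locale data_augmentation =
  fixes P :: "('x::polish_space \<times> 'z::polish_space) measure"
    and \<Pi>2 :: "'x \<Rightarrow> 'z measure"
    and \<Pi>1 :: "'z \<Rightarrow> 'x measure"
  assumes P: "prob_space P" and sets_P: "sets P = sets (borel \<Otimes>\<^sub>M borel)"
    and cond2: "cond_dist2 P \<Pi>2" and cond1: "cond_dist1 P \<Pi>1"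
begin

abbreviation "M1 \<equiv> marginal1 P"
abbreviation "M2 \<equiv> marginal2 P"

lemma sets_M1[measurable_cong, simp]: "sets M1 = sets borel"
  and sets_M2[measurable_cong, simp]: "sets M2 = sets borel"
  by (auto simp: marginal1_def marginal2_def)

lemma space_M1[simp]: "space M1 = UNIV" and space_M2[simp]: "space M2 = UNIV"
  by (auto simp: marginal1_def marginal2_def)

declare sets_P[measurable_cong]

lemma space_P[simp]: "space P = UNIV"
  using sets_eq_imp_space_eq[OF sets_P] by (simp add: space_pair_measure)

lemma prob_space_M1: "prob_space M1"
  unfolding marginal1_def
  by (auto intro!: prob_space.prob_space_distr[OF P])

lemma \<Pi>2[measurable]: "\<Pi>2 \<in> borel \<rightarrow>\<^sub>M prob_algebra borel"
  and \<Pi>1[measurable]: "\<Pi>1 \<in> borel \<rightarrow>\<^sub>M prob_algebra borel"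
  using cond2 cond1 unfolding cond_dist2_def cond_dist1_def by blast+

lemma \<Pi>2_subprob: "\<Pi>2 \<in> M1 \<rightarrow>\<^sub>M subprob_algebra borel"
  and \<Pi>1_subprob: "\<Pi>1 \<in> M2 \<rightarrow>\<^sub>M subprob_algebra borel"
  using measurable_prob_algebraD[OF \<Pi>2] measurable_prob_algebraD[OF \<Pi>1]
  by (simp_all add: measurable_cong_sets[OF sets_M1 refl] measurable_cong_sets[OF sets_M2 refl])

lemma prob_space_\<Pi>2: "prob_space (\<Pi>2 y)" and sets_\<Pi>2[simp, measurable_cong]: "sets (\<Pi>2 y) = sets borel"
  and prob_space_\<Pi>1: "prob_space (\<Pi>1 z)" and sets_\<Pi>1[simp, measurable_cong]: "sets (\<Pi>1 z) = sets borel"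
  using measurable_space[OF \<Pi>2, of y] measurable_space[OF \<Pi>1, of z]
  by (auto simp: space_prob_algebra)

lemma bind2_subprob: "(\<lambda>y. distr (\<Pi>2 y) (borel \<Otimes>\<^sub>M borel) (\<lambda>z. (y, z))) \<in> M1 \<rightarrow>\<^sub>M subprob_algebra (borel \<Otimes>\<^sub>M borel)"
  by (intro measurable_distr2[OF _ \<Pi>2_subprob]) measurable

text \<open>\<open>cond_dist2\<close> speaks of rectangles only. This turns it into an identity of
  measures, from which integrals of arbitrary functions of the pair follow.\<close>

lemma bind2_eq_P: "M1 \<bind> (\<lambda>y. distr (\<Pi>2 y) (borel \<Otimes>\<^sub>M borel) (\<lambda>z. (y, z))) = P" (is "M1 \<bind> ?K = P")
proof -
  have ne: "space M1 \<noteq> {}" by simp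
  show ?thesis
  proof (rule measure_eqI_pair[OF P sets_P sets_bind_measurable[OF bind2_subprob ne], symmetric])
    fix A :: "'x set" and B :: "'z set" assume AB[measurable]: "A \<in> sets borel" "B \<in> sets borel"
    have "emeasure P (A \<times> B) = (\<integral>\<^sup>+y\<in>A. emeasure (\<Pi>2 y) B \<partial>M1)"
      using cond2 AB by (simp add: cond_dist2_def)
    \<comment> \<open>The preimage of the rectangle under \<open>z \<mapsto> (y, z)\<close> is
      \<open>B\<close> if \<open>y\<close> lies in \<open>A\<close>, and empty otherwise.\<close>
    also have "\<dots> = (\<integral>\<^sup>+y. emeasure (?K y) (A \<times> B) \<partial>M1)"
      by (intro nn_integral_cong, subst emeasure_distr)
         (auto simp: indicator_def sets_eq_imp_space_eq[OF sets_\<Pi>2] intro!: arg_cong2[where f=emeasure])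
    also have "\<dots> = emeasure (M1 \<bind> ?K) (A \<times> B)"
      by (rule emeasure_bind[OF ne bind2_subprob, symmetric]) simp
    finally show "emeasure P (A \<times> B) = emeasure (M1 \<bind> ?K) (A \<times> B)" .
  qed
qed

lemma nn_integral_P_\<Pi>2:
  assumes [measurable]: "h \<in> borel_measurable (borel \<Otimes>\<^sub>M borel)"
  shows "(\<integral>\<^sup>+x. h x \<partial>P) = (\<integral>\<^sup>+y. \<integral>\<^sup>+z. h (y, z) \<partial>\<Pi>2 y \<partial>M1)"
  using nn_integral_bind[OF assms bind2_subprob] by (simp add: bind2_eq_P nn_integral_distr)

lemma
  fixes h :: "'x \<times> 'z \<Rightarrow> real"
  assumes h: "integrable P h"
  shows integrable_integral_\<Pi>2: "integrable M1 (\<lambda>y. \<integral>z. h (y, z) \<partial>\<Pi>2 y)"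
    and integral_P_\<Pi>2: "(\<integral>x. h x \<partial>P) = (\<integral>y. \<integral>z. h (y, z) \<partial>\<Pi>2 y \<partial>M1)"
proof -
  have ne: "space M1 \<noteq> {}" by simp
  have c: "case_prod (\<lambda>y z. (y, z)) \<in> M1 \<Otimes>\<^sub>M borel \<rightarrow>\<^sub>M borel \<Otimes>\<^sub>M borel"
    by measurable
  have h': "integrable (M1 \<bind> (\<lambda>y. distr (\<Pi>2 y) (borel \<Otimes>\<^sub>M borel) (\<lambda>z. (y, z)))) h"
    using h by (simp add: bind2_eq_P)
  show "integrable M1 (\<lambda>y. \<integral>z. h (y, z) \<partial>\<Pi>2 y)"
    by (rule integrable_integral_bind_distr[OF \<Pi>2_subprob ne c h'])
  show "(\<integral>x. h x \<partial>P) = (\<integral>y. \<integral>z. h (y, z) \<partial>\<Pi>2 y \<partial>M1)"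
    using integral_bind_distr[OF \<Pi>2_subprob ne c h'] by (simp add: bind2_eq_P)
qed

lemma bind1_subprob: "(\<lambda>z. distr (\<Pi>1 z) (borel \<Otimes>\<^sub>M borel) (\<lambda>y. (y, z))) \<in> M2 \<rightarrow>\<^sub>M subprob_algebra (borel \<Otimes>\<^sub>M borel)"
  by (intro measurable_distr2[OF _ \<Pi>1_subprob]) measurable

lemma bind1_eq_P: "M2 \<bind> (\<lambda>z. distr (\<Pi>1 z) (borel \<Otimes>\<^sub>M borel) (\<lambda>y. (y, z))) = P" (is "M2 \<bind> ?K = P")
proof -
  have ne: "space M2 \<noteq> {}" by simp
  show ?thesis
  proof (rule measure_eqI_pair[OF P sets_P sets_bind_measurable[OF bind1_subprob ne], symmetric])
    fix A :: "'x set" and B :: "'z set" assume AB[measurable]: "A \<in> sets borel" "B \<in> sets borel"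
    have "emeasure P (A \<times> B) = (\<integral>\<^sup>+z\<in>B. emeasure (\<Pi>1 z) A \<partial>M2)"
      using cond1 AB by (simp add: cond_dist1_def)
    also have "\<dots> = (\<integral>\<^sup>+z. emeasure (?K z) (A \<times> B) \<partial>M2)"
      by (intro nn_integral_cong, subst emeasure_distr)
         (auto simp: indicator_def sets_eq_imp_space_eq[OF sets_\<Pi>1] intro!: arg_cong2[where f=emeasure])
    also have "\<dots> = emeasure (M2 \<bind> ?K) (A \<times> B)"
      by (rule emeasure_bind[OF ne bind1_subprob, symmetric]) simp
    finally show "emeasure P (A \<times> B) = emeasure (M2 \<bind> ?K) (A \<times> B)" .
  qed
qed

lemma nn_integral_P_\<Pi>1:
  assumes [measurable]: "h \<in> borel_measurable (borel \<Otimes>\<^sub>M borel)"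
  shows "(\<integral>\<^sup>+x. h x \<partial>P) = (\<integral>\<^sup>+z. \<integral>\<^sup>+y. h (y, z) \<partial>\<Pi>1 z \<partial>M2)"
  using nn_integral_bind[OF assms bind1_subprob] by (simp add: bind1_eq_P nn_integral_distr)

lemma
  fixes h :: "'x \<times> 'z \<Rightarrow> real"
  assumes h: "integrable P h"
  shows AE_integrable_\<Pi>1: "AE z in M2. integrable (\<Pi>1 z) (\<lambda>y. h (y, z))"
    and integrable_integral_\<Pi>1: "integrable M2 (\<lambda>z. \<integral>y. h (y, z) \<partial>\<Pi>1 z)"
    and integral_P_\<Pi>1: "(\<integral>x. h x \<partial>P) = (\<integral>z. \<integral>y. h (y, z) \<partial>\<Pi>1 z \<partial>M2)"
proof -
  have ne: "space M2 \<noteq> {}" by simp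
  have c: "case_prod (\<lambda>z y. (y, z)) \<in> M2 \<Otimes>\<^sub>M borel \<rightarrow>\<^sub>M borel \<Otimes>\<^sub>M borel"
    by measurable
  have h': "integrable (M2 \<bind> (\<lambda>z. distr (\<Pi>1 z) (borel \<Otimes>\<^sub>M borel) (\<lambda>y. (y, z)))) h"
    using h by (simp add: bind1_eq_P)
  show "AE z in M2. integrable (\<Pi>1 z) (\<lambda>y. h (y, z))"
    by (rule AE_integrable_bind_distr[OF \<Pi>1_subprob ne c h'])
  show "integrable M2 (\<lambda>z. \<integral>y. h (y, z) \<partial>\<Pi>1 z)"
    by (rule integrable_integral_bind_distr[OF \<Pi>1_subprob ne c h'])
  show "(\<integral>x. h x \<partial>P) = (\<integral>z. \<integral>y. h (y, z) \<partial>\<Pi>1 z \<partial>M2)"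
    using integral_bind_distr[OF \<Pi>1_subprob ne c h'] by (simp add: bind1_eq_P)
qed

end

section \<open>Jensen's inequality for powers\<close>

text \<open>The convex function \<open>x ^ Suc n\<close> lies above its tangent at \<open>c\<close>
  on the nonnegative half-line.\<close>

lemma tangent_power_Suc:
  fixes x c :: real
  assumes "0 \<le> x" "0 \<le> c"
  shows "real (Suc n) * c ^ n * x \<le> x ^ Suc n + real n * c ^ Suc n"
proof (induction n)
  case (Suc n)
  \<comment> \<open>Multiplying the induction hypothesis by \<open>x\<close> produces
    \<open>x\<^sup>2\<close>, which is then bounded below by its own tangent
    \<open>2 * c * x - c\<^sup>2\<close>.\<close>
  have "real (Suc n) * c ^ n * x * x \<le> (x ^ Suc n + real n * c ^ Suc n) * x"
    using Suc.IH assms(1) by (rule mult_right_mono)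
  moreover have "0 \<le> real (Suc n) * c ^ n * (x - c)\<^sup>2"
    using assms by simp
  ultimately show ?case
    by (simp add: algebra_simps power2_eq_square)
qed simp

lemma Jensen_power_two_weights:
  fixes a v \<gamma> :: "'a \<Rightarrow> real"
  assumes a: "integrable M a" and v: "integrable M v" and \<gamma>[measurable]: "\<gamma> \<in> borel_measurable M"
    and nn: "AE x in M. 0 \<le> a x \<and> 0 \<le> v x" and \<gamma>01: "\<And>x. 0 \<le> \<gamma> x \<and> \<gamma> x \<le> 1"
    and t: "1 \<le> t" and pos: "0 < (\<integral>x. a x + v x \<partial>M)"
  shows "((\<integral>x. a x + \<gamma> x * v x \<partial>M) / (\<integral>x. a x + v x \<partial>M)) ^ t * (\<integral>x. a x + v x \<partial>M)
    \<le> (\<integral>x. a x \<partial>M) + (\<integral>x. \<gamma> x ^ t * v x \<partial>M)"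
proof -
  obtain n where n: "t = Suc n" using t by (cases t) auto
  define N where "N = (\<integral>x. a x + v x \<partial>M)"
  define B where "B = (\<integral>x. a x + \<gamma> x * v x \<partial>M)"
  \<comment> \<open>The tangent point is the weighted mean of the value 1 with weight
    \<open>a\<close> and the value \<open>\<gamma>\<close> with weight \<open>v\<close>;
    \<open>N\<close> is the total weight.\<close>
  define c where "c = B / N"
  note [measurable] = borel_measurable_integrable[OF v]
  have bd: "\<bar>\<gamma> x ^ k * v x\<bar> \<le> \<bar>v x\<bar>" for x k
    using \<gamma>01[of x] by (auto simp: abs_mult power_le_one intro!: mult_left_le_one_le)
  have i: "integrable M (\<lambda>x. \<gamma> x ^ k * v x)" for k
    by (rule Bochner_Integration.integrable_bound[OF v]) (use bd in auto)
  note i1 = i[of 1, simplified]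
  have "0 \<le> B"
    unfolding B_def using nn \<gamma>01 by (intro integral_nonneg_AE) auto
  then have c: "0 \<le> c" using pos by (simp add: c_def N_def)
  have "(\<integral>x. real t * c ^ n * (a x + \<gamma> x * v x) \<partial>M)
      \<le> (\<integral>x. a x + \<gamma> x ^ t * v x + real n * c ^ t * (a x + v x) \<partial>M)"
  proof (rule integral_mono_AE)
    show "AE x in M. real t * c ^ n * (a x + \<gamma> x * v x)
        \<le> a x + \<gamma> x ^ t * v x + real n * c ^ t * (a x + v x)"
      using nn
    proof eventually_elim
      case (elim x)
      have "(real t * c ^ n * 1) * a x \<le> (1 ^ t + real n * c ^ t) * a x"
        using tangent_power_Suc[of 1 c n] c elim unfolding n by (intro mult_right_mono) auto
      moreover have "(real t * c ^ n * \<gamma> x) * v x \<le> (\<gamma> x ^ t + real n * c ^ t) * v x"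
        using tangent_power_Suc[of "\<gamma> x" c n] c elim \<gamma>01[of x] unfolding n
        by (intro mult_right_mono) auto
      ultimately show ?case
        by (simp add: algebra_simps)
    qed
  qed (use a v i i1 in auto)
  also have "\<dots> = (\<integral>x. a x \<partial>M) + (\<integral>x. \<gamma> x ^ t * v x \<partial>M) + real n * c ^ t * N"
    using a v i by (simp add: N_def)
  finally have "real t * c ^ n * B \<le> (\<integral>x. a x \<partial>M) + (\<integral>x. \<gamma> x ^ t * v x \<partial>M) + real n * c ^ t * N"
    by (simp add: B_def)
  \<comment> \<open>Since \<open>B = c * N\<close>, the integrated tangent inequality has
    \<open>t\<close> copies of \<open>c ^ t * N\<close> on the left and \<open>n = t - 1\<close> on
    the right; one remains.\<close>
  moreover have cB: "c ^ n * B = c ^ t * N"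
    using pos by (simp add: n c_def N_def[symmetric])
  have "real t * c ^ n * B = c ^ t * N + real n * c ^ t * N"
    unfolding mult.assoc cB by (simp add: n distrib_right)
  ultimately have "c ^ t * N \<le> (\<integral>x. a x \<partial>M) + (\<integral>x. \<gamma> x ^ t * v x \<partial>M)"
    by linarith
  then show ?thesis
    by (simp add: c_def B_def N_def)
qed

section \<open>The hybrid kernel as a mixture of fiber kernels\<close>

locale hybrid_augmentation = data_augmentation P \<Pi>2 \<Pi>1
  for P :: "('x::polish_space \<times> 'z::polish_space) measure" and \<Pi>2 \<Pi>1 +
  fixes Q :: "'z \<Rightarrow> 'x \<Rightarrow> 'x measure"
  assumes Q_measurable: "(\<lambda>(y, z). Q z y) \<in> borel \<Otimes>\<^sub>M borel \<rightarrow>\<^sub>M prob_algebra borel"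
    and Q_stationary: "\<And>z. stationary_kernel (\<Pi>1 z) (Q z)"
begin

lemma Q_subprob: "(\<lambda>(y, z). Q z y) \<in> P \<rightarrow>\<^sub>M subprob_algebra borel"
  using measurable_prob_algebraD[OF Q_measurable]
  by (simp add: measurable_cong_sets[OF sets_P refl])

lemma emeasure_Q_measurable:
  assumes A: "A \<in> sets borel"
  shows "(\<lambda>w. emeasure (Q (snd w) (fst w)) A) \<in> borel_measurable (borel \<Otimes>\<^sub>M borel)"
  using measurable_emeasure_kernel[OF measurable_prob_algebraD[OF Q_measurable] A]
  by (simp add: split_beta')

lemma Q_section: "(\<lambda>z. Q z y) \<in> \<Pi>2 y' \<rightarrow>\<^sub>M subprob_algebra borel"
  using measurable_compose[OF measurable_Pair1' measurable_prob_algebraD[OF Q_measurable], of y]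
  by (simp add: measurable_cong_sets[OF sets_\<Pi>2 refl])

lemma nonempty_\<Pi>2: "space (\<Pi>2 y) \<noteq> {}"
  by (rule prob_space.not_empty[OF prob_space_\<Pi>2])

text \<open>Given \<open>z\<close>, the first coordinate has law \<open>\<Pi>1 z\<close>, which
  \<open>Q z\<close> leaves invariant. The updated coordinate thus keeps its marginal law.\<close>

lemma P_bind_Q: "P \<bind> (\<lambda>(y, z). Q z y) = M1"
proof (rule measure_eqI)
  have ne: "space P \<noteq> {}" by simp
  show s: "sets (P \<bind> (\<lambda>(y, z). Q z y)) = sets M1"
    using sets_bind_measurable[OF Q_subprob ne] by simp
  fix A assume "A \<in> sets (P \<bind> (\<lambda>(y, z). Q z y))"
  then have A[measurable]: "A \<in> sets borel" using s by simp
  have "emeasure (P \<bind> (\<lambda>(y, z). Q z y)) A = (\<integral>\<^sup>+w. emeasure (Q (snd w) (fst w)) A \<partial>P)"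
    by (subst emeasure_bind[OF ne Q_subprob A]) (simp add: split_beta')
  also have "\<dots> = (\<integral>\<^sup>+z. \<integral>\<^sup>+y. emeasure (Q z y) A \<partial>\<Pi>1 z \<partial>M2)"
    by (simp add: nn_integral_P_\<Pi>1[OF emeasure_Q_measurable[OF A]])
  also have "\<dots> = (\<integral>\<^sup>+z. emeasure (\<Pi>1 z) A \<partial>M2)"
  proof (rule nn_integral_cong)
    fix z
    interpret k: stationary_kernel "\<Pi>1 z" "Q z" by (rule Q_stationary)
    show "(\<integral>\<^sup>+y. emeasure (Q z y) A \<partial>\<Pi>1 z) = emeasure (\<Pi>1 z) A"
      using emeasure_bind[OF k.not_empty k.kernel_subprob, of A] by (simp add: k.stationary)
  qed
  also have "\<dots> = (\<integral>\<^sup>+z. \<integral>\<^sup>+y. indicator A y \<partial>\<Pi>1 z \<partial>M2)"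
    by simp
  also have "\<dots> = (\<integral>\<^sup>+w. indicator A (fst w) \<partial>P)"
    by (subst nn_integral_P_\<Pi>1) simp_all
  also have "\<dots> = emeasure M1 A"
    unfolding marginal1_def using nn_integral_distr[of fst P borel "indicator A"] by simp
  finally show "emeasure (P \<bind> (\<lambda>(y, z). Q z y)) A = emeasure M1 A" .
qed

lemma DA_hybrid_measurable: "DA_hybrid \<Pi>2 Q \<in> borel \<rightarrow>\<^sub>M prob_algebra borel"
  unfolding DA_hybrid_def[abs_def]
  by (rule measurable_bind_prob_space2[OF \<Pi>2 Q_measurable])

text \<open>Conditioning on \<open>y\<close> first, one hybrid step from \<open>M1\<close> is the
  update of \<open>P_bind_Q\<close>.\<close>

lemma stationary_DA_hybrid: "stationary_kernel M1 (DA_hybrid \<Pi>2 Q)"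
proof (intro stationary_kernel.intro stationary_kernel_axioms.intro prob_space_M1)
  show M: "Mtk M1 (DA_hybrid \<Pi>2 Q)"
    using DA_hybrid_measurable unfolding Mtk_cong[OF sets_M1] by (simp add: Mtk_def)
  have K: "DA_hybrid \<Pi>2 Q \<in> M1 \<rightarrow>\<^sub>M subprob_algebra borel"
    using measurable_prob_algebraD[OF DA_hybrid_measurable]
    by (simp add: measurable_cong_sets[OF sets_M1 refl])
  have ne: "space M1 \<noteq> {}" "space P \<noteq> {}" by simp_all
  show "M1 \<bind> DA_hybrid \<Pi>2 Q = M1"
  proof (rule measure_eqI)
    show s: "sets (M1 \<bind> DA_hybrid \<Pi>2 Q) = sets M1"
      using sets_bind_measurable[OF K ne(1)] by simp
    fix A assume "A \<in> sets (M1 \<bind> DA_hybrid \<Pi>2 Q)"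
    then have A[measurable]: "A \<in> sets borel" using s by simp
    have "emeasure (M1 \<bind> DA_hybrid \<Pi>2 Q) A = (\<integral>\<^sup>+y. \<integral>\<^sup>+z. emeasure (Q z y) A \<partial>\<Pi>2 y \<partial>M1)"
      unfolding emeasure_bind[OF ne(1) K A] DA_hybrid_def
      by (intro nn_integral_cong emeasure_bind[OF nonempty_\<Pi>2 Q_section A])
    also have "\<dots> = (\<integral>\<^sup>+w. emeasure (Q (snd w) (fst w)) A \<partial>P)"
      by (simp add: nn_integral_P_\<Pi>2[OF emeasure_Q_measurable[OF A]])
    also have "\<dots> = emeasure (P \<bind> (\<lambda>(y, z). Q z y)) A"
      by (subst emeasure_bind[OF ne(2) Q_subprob A]) (simp add: split_beta')
    finally show "emeasure (M1 \<bind> DA_hybrid \<Pi>2 Q) A = emeasure M1 A"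
      by (simp add: P_bind_Q)
  qed
qed

text \<open>Both sides are the integral under \<open>P\<close> of \<open>f(y)\<close> times the
  \<open>Q z y\<close>-mean of \<open>f\<close>, disintegrated once over \<open>y\<close> and once
  over \<open>z\<close>.\<close>

lemma
  assumes f: "f \<in> L2 M1"
  shows integrable_fiber_inner: "integrable M2 (\<lambda>z. L2_inner (\<Pi>1 z) f (kernel_op (Q z) f))"
    and L2_inner_DA_hybrid: "L2_inner M1 f (kernel_op (DA_hybrid \<Pi>2 Q) f)
      = (\<integral>z. L2_inner (\<Pi>1 z) f (kernel_op (Q z) f) \<partial>M2)"
proof -
  interpret S: stationary_kernel M1 "DA_hybrid \<Pi>2 Q" by (rule stationary_DA_hybrid)
  have Qp: "(\<lambda>(y, z). Q z y) \<in> P \<rightarrow>\<^sub>M prob_algebra borel"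
    using Q_measurable by (simp add: measurable_cong_sets[OF sets_P refl])
  have fm[measurable]: "f \<in> borel_measurable borel"
    using f by (simp add: L2_def measurable_cong_sets[OF sets_M1 refl])
  have "(\<lambda>w. f (fst w)) \<in> L2 P"
    using f unfolding L2_def marginal1_def by (auto simp: integrable_distr_eq)
  \<comment> \<open>The kernel carries \<open>P\<close> to \<open>M1\<close> by
    \<open>P_bind_Q\<close>, so square-integrability under \<open>M1\<close> passes to
    \<open>P\<close>; the product is then integrable.\<close>
  moreover have "(\<lambda>w. \<integral>y'. f y' \<partial>(case w of (y, z) \<Rightarrow> Q z y)) \<in> L2 P"
    by (rule L2_kernel_op[OF P Qp]) (simp add: P_bind_Q f)
  ultimately have h: "integrable P (\<lambda>w. f (fst w) * (\<integral>y'. f y' \<partial>(case w of (y, z) \<Rightarrow> Q z y)))"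
    by (rule L2_mult_integrable)
  show "integrable M2 (\<lambda>z. L2_inner (\<Pi>1 z) f (kernel_op (Q z) f))"
    using integrable_integral_\<Pi>1[OF h] by (simp add: L2_inner_def kernel_op_def)
  have ae: "AE y in M1. f y * kernel_op (DA_hybrid \<Pi>2 Q) f y
      = (\<integral>z. f y * (\<integral>y'. f y' \<partial>Q z y) \<partial>\<Pi>2 y)"
    using S.AE_kernel_integrable[OF f]
  proof eventually_elim
    case (elim y)
    show ?case
      using integral_bind_integrable[OF Q_section nonempty_\<Pi>2 elim[unfolded DA_hybrid_def]]
      by (simp add: kernel_op_def DA_hybrid_def)
  qed
  have "L2_inner M1 f (kernel_op (DA_hybrid \<Pi>2 Q) f)
      = (\<integral>y. \<integral>z. f y * (\<integral>y'. f y' \<partial>Q z y) \<partial>\<Pi>2 y \<partial>M1)"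
    unfolding L2_inner_def
    using f S.kernel_op_L2(1)[OF f] borel_measurable_integrable[OF integrable_integral_\<Pi>2[OF h]]
    by (intro integral_cong_AE ae) (auto simp: L2_def)
  also have "\<dots> = (\<integral>z. L2_inner (\<Pi>1 z) f (kernel_op (Q z) f) \<partial>M2)"
    using integral_P_\<Pi>2[OF h] integral_P_\<Pi>1[OF h] by (simp add: L2_inner_def kernel_op_def)
  finally show "L2_inner M1 f (kernel_op (DA_hybrid \<Pi>2 Q) f)
      = (\<integral>z. L2_inner (\<Pi>1 z) f (kernel_op (Q z) f) \<partial>M2)" .
qed

end

section \<open>Fiber moments and the exact kernel\<close>

context data_augmentation
begin

text \<open>The exact kernel is the hybrid kernel whose fiber update forgets \<open>y\<close> and
  redraws from \<open>\<Pi>1 z\<close>. Its image of \<open>f\<close> is then constant in each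
  fiber, so the fiber inner product is a squared mean.\<close>

lemma
  assumes f: "f \<in> L2 M1"
  shows integrable_fiber_mean: "integrable M2 (\<lambda>z. (\<integral>y. f y \<partial>\<Pi>1 z)\<^sup>2)"
    and L2_inner_DA_exact: "L2_inner M1 f (kernel_op (DA_exact \<Pi>2 \<Pi>1) f)
      = (\<integral>z. (\<integral>y. f y \<partial>\<Pi>1 z)\<^sup>2 \<partial>M2)"
proof -
  interpret E: hybrid_augmentation P \<Pi>2 \<Pi>1 "\<lambda>z y. \<Pi>1 z"
  proof (intro hybrid_augmentation.intro hybrid_augmentation_axioms.intro data_augmentation_axioms)
    show "(\<lambda>(y, z). \<Pi>1 z) \<in> borel \<Otimes>\<^sub>M borel \<rightarrow>\<^sub>M prob_algebra borel"
      by measurable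
    fix z
    interpret prob_space "\<Pi>1 z" by (rule prob_space_\<Pi>1)
    show "stationary_kernel (\<Pi>1 z) (\<lambda>y. \<Pi>1 z)"
      by (intro stationary_kernel.intro stationary_kernel_axioms.intro prob_space_\<Pi>1)
         (auto simp: Mtk_def space_prob_algebra prob_space_\<Pi>1 bind_const' prob_space_imp_subprob_space)
  qed
  have "DA_hybrid \<Pi>2 (\<lambda>z y. \<Pi>1 z) = DA_exact \<Pi>2 \<Pi>1"
    by (simp add: DA_hybrid_def DA_exact_def fun_eq_iff)
  then show "integrable M2 (\<lambda>z. (\<integral>y. f y \<partial>\<Pi>1 z)\<^sup>2)"
    and "L2_inner M1 f (kernel_op (DA_exact \<Pi>2 \<Pi>1) f) = (\<integral>z. (\<integral>y. f y \<partial>\<Pi>1 z)\<^sup>2 \<partial>M2)"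
    using E.integrable_fiber_inner[OF f] E.L2_inner_DA_hybrid[OF f]
    by (simp_all add: L2_inner_def kernel_op_def power2_eq_square)
qed

lemma
  assumes f: "f \<in> L2 M1"
  shows AE_L2_\<Pi>1: "AE z in M2. f \<in> L2 (\<Pi>1 z)"
    and integrable_fiber_square: "integrable M2 (\<lambda>z. \<integral>y. (f y)\<^sup>2 \<partial>\<Pi>1 z)"
    and integral_fiber_square: "(\<integral>z. \<integral>y. (f y)\<^sup>2 \<partial>\<Pi>1 z \<partial>M2) = (L2_norm M1 f)\<^sup>2"
proof -
  have fm[measurable]: "f \<in> borel_measurable borel"
    using f by (simp add: L2_def measurable_cong_sets[OF sets_M1 refl])
  have h: "integrable P (\<lambda>w. (f (fst w))\<^sup>2)"
    using f unfolding L2_def marginal1_def by (auto simp: integrable_distr_eq)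
  show "AE z in M2. f \<in> L2 (\<Pi>1 z)"
    using AE_integrable_\<Pi>1[OF h]
    by eventually_elim (simp add: L2_def measurable_cong_sets[OF sets_\<Pi>1 refl])
  show "integrable M2 (\<lambda>z. \<integral>y. (f y)\<^sup>2 \<partial>\<Pi>1 z)"
    using integrable_integral_\<Pi>1[OF h] by simp
  have "(L2_norm M1 f)\<^sup>2 = (\<integral>w. (f (fst w))\<^sup>2 \<partial>P)"
    unfolding L2_norm_power2 marginal1_def by (subst integral_distr) auto
  then show "(\<integral>z. \<integral>y. (f y)\<^sup>2 \<partial>\<Pi>1 z \<partial>M2) = (L2_norm M1 f)\<^sup>2"
    using integral_P_\<Pi>1[OF h] by simp
qed

text \<open>The common quantity is the integral of \<open>f(y)\<^sup>2 * g(z)\<close> under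
  \<open>P\<close>. Conditioning on \<open>y\<close> first pulls the square out and leaves the
  average of \<open>g\<close>, bounded by \<open>\<alpha>\<close>.\<close>

lemma
  fixes g :: "'z \<Rightarrow> real"
  assumes f: "f \<in> L2 M1" and g[measurable]: "g \<in> borel_measurable borel"
    and g01: "\<And>z. 0 \<le> g z \<and> g z \<le> 1"
    and \<alpha>: "AE y in M1. (\<integral>z. g z \<partial>\<Pi>2 y) \<le> \<alpha>"
  shows integrable_weighted_square: "integrable M2 (\<lambda>z. g z * (\<integral>y. (f y)\<^sup>2 \<partial>\<Pi>1 z))"
    and integral_weighted_square_le:
      "(\<integral>z. g z * (\<integral>y. (f y)\<^sup>2 \<partial>\<Pi>1 z) \<partial>M2) \<le> \<alpha> * (L2_norm M1 f)\<^sup>2"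
proof -
  have fm[measurable]: "f \<in> borel_measurable borel"
    using f by (simp add: L2_def measurable_cong_sets[OF sets_M1 refl])
  have f2: "integrable P (\<lambda>w. (f (fst w))\<^sup>2)"
    using f unfolding L2_def marginal1_def by (auto simp: integrable_distr_eq)
  have h: "integrable P (\<lambda>w. (f (fst w))\<^sup>2 * g (snd w))"
    using g01 by (intro Bochner_Integration.integrable_bound[OF f2])
      (auto simp: abs_mult abs_of_nonneg intro!: mult_right_le_one_le)
  show "integrable M2 (\<lambda>z. g z * (\<integral>y. (f y)\<^sup>2 \<partial>\<Pi>1 z))"
    using integrable_integral_\<Pi>1[OF h] by (simp add: mult.commute)
  have "(\<integral>z. g z * (\<integral>y. (f y)\<^sup>2 \<partial>\<Pi>1 z) \<partial>M2) = (\<integral>y. (f y)\<^sup>2 * (\<integral>z. g z \<partial>\<Pi>2 y) \<partial>M1)"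
    using integral_P_\<Pi>1[OF h] integral_P_\<Pi>2[OF h] by (simp add: mult.commute)
  also have "\<dots> \<le> (\<integral>y. (f y)\<^sup>2 * \<alpha> \<partial>M1)"
  proof (rule integral_mono_AE)
    show "integrable M1 (\<lambda>y. (f y)\<^sup>2 * (\<integral>z. g z \<partial>\<Pi>2 y))"
      using integrable_integral_\<Pi>2[OF h] by simp
    show "integrable M1 (\<lambda>y. (f y)\<^sup>2 * \<alpha>)"
      using f by (simp add: L2_def)
    show "AE y in M1. (f y)\<^sup>2 * (\<integral>z. g z \<partial>\<Pi>2 y) \<le> (f y)\<^sup>2 * \<alpha>"
      using \<alpha> by eventually_elim (simp add: mult_left_mono)
  qed
  also have "\<dots> = \<alpha> * (L2_norm M1 f)\<^sup>2"
    by (simp add: L2_norm_power2)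
  finally show "(\<integral>z. g z * (\<integral>y. (f y)\<^sup>2 \<partial>\<Pi>1 z) \<partial>M2) \<le> \<alpha> * (L2_norm M1 f)\<^sup>2" .
qed

end

section \<open>The power bound and the conclusion\<close>

context hybrid_augmentation
begin

text \<open>With the absolute value the upper bound holds for every positive \<open>t\<close>;
  parity and positivity matter only for the lower bound 0.\<close>

lemma power_L2_inner_DA_hybrid_le:
  fixes \<gamma> :: "'z \<Rightarrow> real"
  assumes f: "f \<in> L2 M1" and f0: "0 < L2_norm M1 f"
    and \<gamma>[measurable]: "\<gamma> \<in> borel_measurable borel" and \<gamma>01: "\<And>z. 0 \<le> \<gamma> z \<and> \<gamma> z \<le> 1"
    and norm_le: "AE z in M2. kernel_norm (\<Pi>1 z) (Q z) \<le> \<gamma> z"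
    and t: "1 \<le> t" and \<alpha>: "AE y in M1. (\<integral>z. \<gamma> z ^ t \<partial>\<Pi>2 y) \<le> \<alpha>"
  shows "\<bar>L2_inner M1 f (kernel_op (DA_hybrid \<Pi>2 Q) f)\<bar> ^ t / L2_norm M1 f ^ (2 * t)
    \<le> L2_inner M1 f (kernel_op (DA_exact \<Pi>2 \<Pi>1) f) / (L2_norm M1 f)\<^sup>2 + \<alpha>"
proof -
  define N where "N = (L2_norm M1 f)\<^sup>2"
  define m where "m = (\<lambda>z. (\<integral>y. f y \<partial>\<Pi>1 z)\<^sup>2)"
  define e where "e = (\<lambda>z. \<integral>y. (f y)\<^sup>2 \<partial>\<Pi>1 z)"
  define q where "q = (\<lambda>z. L2_inner (\<Pi>1 z) f (kernel_op (Q z) f))"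
  define B where "B = (\<integral>z. m z + \<gamma> z * (e z - m z) \<partial>M2)"
  have N: "0 < N" using f0 by (simp add: N_def)
  have im: "integrable M2 m" and ie: "integrable M2 e" and iq: "integrable M2 q"
    unfolding m_def e_def q_def
    by (rule integrable_fiber_mean integrable_fiber_square integrable_fiber_inner, rule f)+
  have \<gamma>M[measurable]: "\<gamma> \<in> borel_measurable M2"
    by measurable
  have iv: "integrable M2 (\<lambda>z. e z - m z)" using im ie by simp
  \<comment> \<open>The exponent 1 serves the bound \<open>B\<close>, the exponent \<open>t\<close>
    the result of Jensen's inequality.\<close>
  have i\<gamma>: "integrable M2 (\<lambda>z. \<gamma> z ^ k * (e z - m z))" for k
    by (rule Bochner_Integration.integrable_bound[OF iv])
       (use \<gamma>01 iv in \<open>auto simp: abs_mult power_le_one intro!: mult_left_le_one_le\<close>)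
  have me: "AE z in M2. 0 \<le> m z \<and> 0 \<le> e z - m z"
    using AE_L2_\<Pi>1[OF f]
  proof eventually_elim
    case (elim z)
    show ?case
      using prob_space.power2_expectation_le[OF prob_space_\<Pi>1 elim] by (simp add: m_def e_def)
  qed
  have qb: "AE z in M2. \<bar>q z\<bar> \<le> m z + \<gamma> z * (e z - m z)"
    using AE_L2_\<Pi>1[OF f] norm_le
  proof eventually_elim
    case (elim z)
    show ?case
      using stationary_kernel.abs_L2_inner_kernel_le[OF Q_stationary elim]
      by (simp add: q_def m_def e_def)
  qed
  have "\<bar>\<integral>z. q z \<partial>M2\<bar> \<le> (\<integral>z. \<bar>q z\<bar> \<partial>M2)"
    by (rule integral_abs_bound)
  also have "\<dots> \<le> B"
    unfolding B_def using iq im i\<gamma>[of 1] by (intro integral_mono_AE qb) auto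
  finally have qB: "\<bar>\<integral>z. q z \<partial>M2\<bar> \<le> B" .
  have sum: "(\<integral>z. m z + (e z - m z) \<partial>M2) = N"
    using integral_fiber_square[OF f] by (simp add: e_def N_def)
  have "(B / N) ^ t * N \<le> (\<integral>z. m z \<partial>M2) + (\<integral>z. \<gamma> z ^ t * (e z - m z) \<partial>M2)"
    using Jensen_power_two_weights[OF im iv \<gamma>M me \<gamma>01 t] N unfolding sum B_def by simp
  \<comment> \<open>Unlike the variance \<open>e z - m z\<close>, the second moment
    \<open>e z\<close> integrates a function of \<open>y\<close> that does not depend on
    \<open>z\<close>, so the order of conditioning can be switched.\<close>
  also have "(\<integral>z. \<gamma> z ^ t * (e z - m z) \<partial>M2) \<le> (\<integral>z. \<gamma> z ^ t * e z \<partial>M2)"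
  proof (rule integral_mono_AE[OF i\<gamma>])
    show "integrable M2 (\<lambda>z. \<gamma> z ^ t * e z)"
      unfolding e_def using \<gamma>01 by (intro integrable_weighted_square[OF f _ _ \<alpha>]) (auto simp: power_le_one)
    show "AE z in M2. \<gamma> z ^ t * (e z - m z) \<le> \<gamma> z ^ t * e z"
      using me by eventually_elim (use \<gamma>01 in \<open>simp add: mult_left_mono\<close>)
  qed
  also have "\<dots> \<le> \<alpha> * N"
    unfolding e_def N_def using \<gamma>01
    by (intro integral_weighted_square_le[OF f _ _ \<alpha>]) (auto simp: power_le_one)
  finally have "(B / N) ^ t * N \<le> (\<integral>z. m z \<partial>M2) + \<alpha> * N"
    by simp
  then have "(B / N) ^ t \<le> (\<integral>z. m z \<partial>M2) / N + \<alpha>"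
    using N by (simp add: field_simps)
  moreover have "(\<bar>\<integral>z. q z \<partial>M2\<bar> / N) ^ t \<le> (B / N) ^ t"
    using qB N by (intro power_mono divide_right_mono) auto
  ultimately have "(\<bar>\<integral>z. q z \<partial>M2\<bar> / N) ^ t \<le> (\<integral>z. m z \<partial>M2) / N + \<alpha>"
    by linarith
  then show ?thesis
    by (simp add: L2_inner_DA_hybrid[OF f] L2_inner_DA_exact[OF f] q_def m_def N_def
        power_divide power_mult)
qed

lemma L2_inner_DA_hybrid_nonneg:
  assumes f: "f \<in> L2 M1" and psd: "AE z in M2. pos_semidef (\<Pi>1 z) (Q z)"
  shows "0 \<le> L2_inner M1 f (kernel_op (DA_hybrid \<Pi>2 Q) f)"
  unfolding L2_inner_DA_hybrid[OF f]
proof (rule integral_nonneg_AE)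
  show "AE z in M2. 0 \<le> L2_inner (\<Pi>1 z) f (kernel_op (Q z) f)"
    using AE_L2_\<Pi>1[OF f] psd
    by eventually_elim (rule stationary_kernel.pos_semidef_L2_inner_nonneg[OF Q_stationary])
qed

end

theorem theorem8:
  fixes P :: "('x::polish_space \<times> 'z::polish_space) measure"
    and \<Pi>2 :: "'x \<Rightarrow> 'z measure"
    and \<Pi>1 :: "'z \<Rightarrow> 'x measure"
    and Q :: "'z \<Rightarrow> 'x \<Rightarrow> 'x measure"
    and \<gamma> :: "'z \<Rightarrow> real"
    and t :: nat
    and \<alpha> :: real
  assumes "prob_space P" and "sets P = sets (borel \<Otimes>\<^sub>M borel)"
    and "cond_dist2 P \<Pi>2" and "cond_dist1 P \<Pi>1"
    and "\<And>z. Mtk borel (Q z)"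
    and "\<And>z. reversible (\<Pi>1 z) (Q z)"
    and "\<And>A. A \<in> sets borel \<Longrightarrow>
           (\<lambda>(y, z). measure (Q z y) A) \<in> borel_measurable (borel \<Otimes>\<^sub>M borel)"
    and "\<gamma> \<in> borel_measurable borel" and "\<And>z. 0 \<le> \<gamma> z \<and> \<gamma> z \<le> 1"
    and "AE z in marginal2 P. kernel_norm (\<Pi>1 z) (Q z) \<le> \<gamma> z"
    and "t \<ge> 1"
    and "0 \<le> \<alpha>" and "\<alpha> \<le> 1"
    and "AE y in marginal1 P. (\<integral>z. \<gamma> z ^ t \<partial>\<Pi>2 y) \<le> \<alpha>"
    and "even t \<or> (AE z in marginal2 P. pos_semidef (\<Pi>1 z) (Q z))"
  shows "\<forall>f \<in> L20 (marginal1 P). \<not> (AE y in marginal1 P. f y = 0) \<longrightarrow>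
     0 \<le> L2_inner (marginal1 P) f (kernel_op (DA_hybrid \<Pi>2 Q) f) ^ t
            / L2_norm (marginal1 P) f ^ (2 * t) \<and>
     L2_inner (marginal1 P) f (kernel_op (DA_hybrid \<Pi>2 Q) f) ^ t
            / L2_norm (marginal1 P) f ^ (2 * t)
       \<le> L2_inner (marginal1 P) f (kernel_op (DA_exact \<Pi>2 \<Pi>1) f)
            / (L2_norm (marginal1 P) f)\<^sup>2 + \<alpha>"
proof (intro ballI impI)
  interpret data_augmentation P \<Pi>2 \<Pi>1
    using assms(1-4) by (rule data_augmentation.intro)
  have prob_Q: "prob_space (Q z y)" and sets_Q: "sets (Q z y) = sets borel" for z y
    using measurable_space[OF assms(5)[unfolded Mtk_def], of y z] by (auto simp: space_prob_algebra)
  interpret hybrid_augmentation P \<Pi>2 \<Pi>1 Q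
  proof (intro hybrid_augmentation.intro hybrid_augmentation_axioms.intro data_augmentation_axioms)
    show "(\<lambda>(y, z). Q z y) \<in> borel \<Otimes>\<^sub>M borel \<rightarrow>\<^sub>M prob_algebra borel"
    \<comment> \<open>Measurability of a kernel is tested on each set \<open>A\<close>; as every
      \<open>Q z y\<close> is finite, the real-valued hypothesis carries over to
      \<open>emeasure\<close>.\<close>
    proof (intro measurable_prob_algebraI measurable_subprob_algebra)
      fix A :: "'x set" assume A: "A \<in> sets borel"
      have eq: "(\<lambda>a. emeasure (case a of (y, z) \<Rightarrow> Q z y) A)
          = (\<lambda>a. ennreal (case a of (y, z) \<Rightarrow> measure (Q z y) A))"
        by (auto simp: fun_eq_iff finite_measure.emeasure_eq_measure[OF prob_space.finite_measure[OF prob_Q]])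
      show "(\<lambda>a. emeasure (case a of (y, z) \<Rightarrow> Q z y) A) \<in> borel_measurable (borel \<Otimes>\<^sub>M borel)"
        unfolding eq using assms(7)[OF A] by (rule measurable_compose[OF _ measurable_ennreal])
    qed (auto simp: prob_Q sets_Q prob_space_imp_subprob_space)
    show "stationary_kernel (\<Pi>1 z) (Q z)" for z
    proof (intro stationary_kernel.intro stationary_kernel_axioms.intro prob_space_\<Pi>1)
      show M: "Mtk (\<Pi>1 z) (Q z)"
        using assms(5) by (simp add: Mtk_cong[OF sets_\<Pi>1])
      show "\<Pi>1 z \<bind> Q z = \<Pi>1 z"
        by (rule reversible_bind[OF prob_space_\<Pi>1 M assms(6)])
    qed
  qed
  fix f assume "f \<in> L20 M1" and nz: "\<not> (AE y in M1. f y = 0)"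
  then have f: "f \<in> L2 M1" by (simp add: L20_def)
  let ?I = "L2_inner M1 f (kernel_op (DA_hybrid \<Pi>2 Q) f)"
  have "0 \<le> ?I ^ t"
    \<comment> \<open>An even power is nonnegative; otherwise the base is, by positivity in almost
      every fiber.\<close>
    using assms(15) L2_inner_DA_hybrid_nonneg[OF f] by auto
  moreover have "?I ^ t / L2_norm M1 f ^ (2 * t) \<le> \<bar>?I\<bar> ^ t / L2_norm M1 f ^ (2 * t)"
    using power_mono_even abs_ge_self[of "?I ^ t"] L2_norm_nonneg[of M1 f]
    by (intro divide_right_mono) (auto simp: power_abs)
  moreover note power_L2_inner_DA_hybrid_le[OF f L2_norm_pos[OF f nz] assms(8,9,10,11,14)]
  ultimately show "0 \<le> ?I ^ t / L2_norm M1 f ^ (2 * t) \<and> ?I ^ t / L2_norm M1 f ^ (2 * t)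
      \<le> L2_inner M1 f (kernel_op (DA_exact \<Pi>2 \<Pi>1) f) / (L2_norm M1 f)\<^sup>2 + \<alpha>"
    using L2_norm_nonneg[of M1 f] by (intro conjI divide_nonneg_nonneg) (auto intro: order_trans)
qed

end
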